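(* Let $Z\colon \Theta \to (0,\infty)$ be measurable with $C_Z\in(0,\infty)$, and let $\widetilde Z\colon \Omega \times \Theta\to (0,\infty)$ be a random function such that $C_{\widetilde Z(\omega,\cdot)}\in(0,\infty)$ for every $\omega\in\Omega$. Let $\pi_Z$ and $\pi_{\widetilde Z(\omega)}:=\pi_{\widetilde Z(\omega,\cdot)}$, $\omega\in\Omega$, be the associated probability measures on $\Theta$. Then $$ \mathbb{E} \Vert \pi_Z - \pi_{\widetilde Z(\cdot)} \Vert_{\rm tv} \leq 2 \int_\Theta \mathbb{E} \left \vert \frac{Z(\theta)}{\widetilde Z(\cdot,\theta)} -1 \right \vert \pi_Z(\mathrm{d} \theta) \leq 2 \int_{\Theta} \left( \mathbb{E}\left[\left \vert \frac{\widetilde Z(\cdot,\theta)}{Z(\theta)}-1 \right \vert^2\right] \right)^{1/2} \left(\mathbb{E}\left[ \left(\frac{Z(\theta)}{\widetilde Z(\cdot,\theta)}\right)^2 \right]\right)^{1/2} \pi_Z(\mathrm{d} \theta). $$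
   Context: $(\Theta,d)$ is a complete separable metric space with Borel $\sigma$-algebra $\mathcal{B}(\Theta)$ and a $\sigma$-finite reference measure $\mu$; $\Phi\colon\Theta\to(-\infty,\infty)$ is a fixed measurable function. For measurable $Z\colon\Theta\to(0,\infty)$ set $C_Z := \int_\Theta \frac{\exp(-\Phi(\theta))}{Z(\theta)}\,\mu(\mathrm{d}\theta)$, and if $C_Z\in(0,\infty)$ define the probability measure $\pi_Z(A) := \frac{1}{C_Z}\int_A \frac{\exp(-\Phi(\theta))}{Z(\theta)}\,\mu(\mathrm{d}\theta)$ for $A\in\mathcal{B}(\Theta)$; the same notation is used with any other measurable function $\Theta\to(0,\infty)$ in place of $Z$. $(\Omega,\mathcal{F},\mathbb{P})$ is a probability space with expectation $\mathbb{E}$. A random function is a jointly measurable function $\widetilde Z\colon\Omega\times\Theta\to(0,\infty)$. Total variation distance (note the normalization): $\Vert \nu_1-\nu_2\Vert_{\rm tv} := \sup_{|f|_\infty\le 1}\left|\int f\,\mathrm{d}\nu_1-\int f\,\mathrm{d}\nu_2\right|$, the supremum being over measurable $f\colon\Theta\to\mathbb{R}$ with $|f|_\infty := \sup_{\theta\in\Theta}|f(\theta)|\le 1$. The map $\omega\mapsto\Vert\pi_Z-\pi_{\widetilde Z(\omega,\cdot)}\Vert_{\rm tv}$ is measurable. *)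

theory Defs
  imports "HOL-Probability.Probability"
begin

definition norm_const :: "'a measure \<Rightarrow> ('a \<Rightarrow> real) \<Rightarrow> ('a \<Rightarrow> real) \<Rightarrow> ennreal"
  where "norm_const \<mu> \<Phi> Z = (\<integral>\<^sup>+\<theta>. ennreal (exp (- \<Phi> \<theta>) / Z \<theta>) \<partial>\<mu>)"

definition gibbs :: "'a measure \<Rightarrow> ('a \<Rightarrow> real) \<Rightarrow> ('a \<Rightarrow> real) \<Rightarrow> 'a measure"
  where "gibbs \<mu> \<Phi> Z =
    scale_measure (1 / norm_const \<mu> \<Phi> Z) (density \<mu> (\<lambda>\<theta>. ennreal (exp (- \<Phi> \<theta>) / Z \<theta>)))"

lemma emeasure_gibbs:
  assumes "sets \<mu> = sets borel"
    and "\<Phi> \<in> borel_measurable borel" and "Z \<in> borel_measurable borel" and "A \<in> sets borel"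
  shows "emeasure (gibbs \<mu> \<Phi> Z) A =
    1 / norm_const \<mu> \<Phi> Z * (\<integral>\<^sup>+\<theta>\<in>A. ennreal (exp (- \<Phi> \<theta>) / Z \<theta>) \<partial>\<mu>)"
proof -
  note assms(1)[measurable_cong] assms(2-4)[measurable]
  show ?thesis unfolding gibbs_def by (simp add: emeasure_density)
qed

lemma prob_space_gibbs:
  assumes "sets \<mu> = sets borel"
    and "\<Phi> \<in> borel_measurable borel" and "Z \<in> borel_measurable borel"
    and "0 < norm_const \<mu> \<Phi> Z" and "norm_const \<mu> \<Phi> Z < \<infinity>"
  shows "prob_space (gibbs \<mu> \<Phi> Z)"
proof
  have sp: "space \<mu> = UNIV" "space (gibbs \<mu> \<Phi> Z) = UNIV"
    using sets_eq_imp_space_eq[OF assms(1)] by (simp_all add: gibbs_def space_scale_measure)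
  have "emeasure (gibbs \<mu> \<Phi> Z) UNIV = 1 / norm_const \<mu> \<Phi> Z * norm_const \<mu> \<Phi> Z"
    using emeasure_gibbs[OF assms(1-3), of UNIV] by (simp add: norm_const_def)
  also have "\<dots> = 1"
    using assms(4,5) by (simp add: ennreal_divide_times ennreal_divide_self)
  finally show "emeasure (gibbs \<mu> \<Phi> Z) (space (gibbs \<mu> \<Phi> Z)) = 1"
    by (simp add: sp)
qed

text \<open>
  No factor 1/2, so the distance of two probability measures lies between 0 and 2. It is meant
  for finite measures on the Borel sets, where every \<open>f\<close> in the supremum is integrable.
\<close>

definition tv_dist :: "'a::topological_space measure \<Rightarrow> 'a measure \<Rightarrow> ennreal"
  where "tv_dist \<nu>1 \<nu>2 =
    (SUP f \<in> {f :: 'a \<Rightarrow> real. f \<in> borel_measurable borel \<and> (\<forall>\<theta>. \<bar>f \<theta>\<bar> \<le> 1)}.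
      ennreal \<bar>(\<integral>\<theta>. f \<theta> \<partial>\<nu>1) - (\<integral>\<theta>. f \<theta> \<partial>\<nu>2)\<bar>)"

text \<open>The square root on \<open>[0, \<infinity>]\<close>: the moments below may be infinite.\<close>

definition ennsqrt :: "ennreal \<Rightarrow> ennreal"
  where "ennsqrt x = (if x = \<infinity> then \<infinity> else ennreal (sqrt (enn2real x)))"

end

theory Submission
  imports Defs
begin

text \<open>
  Write \<open>\<nu>\<close> for the measure with weight \<open>Z\<close> and \<open>r = Z / Y\<close> for a competing weight \<open>Y\<close>. The measure
  with weight \<open>Y\<close> is absolutely continuous with respect to \<open>\<nu>\<close>, with density \<open>r / m\<close>; since both
  are probability measures, \<open>m = \<integral>r d\<nu>\<close>, the ratio of the two normalizing constants. Hence the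
  normalizing constants need no separate estimate: against a test function bounded by one, the
  measures differ by at most
    \<open>\<integral>\<bar>1 - r/m\<bar> d\<nu> \<le> \<integral>\<bar>1 - r\<bar> d\<nu> + \<integral>\<bar>r - r/m\<bar> d\<nu> = \<integral>\<bar>1 - r\<bar> d\<nu> + \<bar>m - 1\<bar>\<close>,
  and \<open>\<bar>m - 1\<bar> = \<bar>\<integral>(r - 1) d\<nu>\<bar> \<le> \<integral>\<bar>r - 1\<bar> d\<nu>\<close>. This gives the factor 2
  (\<open>tv_dist_normalized_density_le\<close> and \<open>tv_dist_gibbs_le\<close>).

  The first inequality of the theorem is this bound for \<open>Y = Zt \<omega>\<close>, averaged over \<open>\<omega>\<close>, with the
  order of integration exchanged by Tonelli. For the second one, factor
  \<open>\<bar>Z/Zt - 1\<bar> = \<bar>Zt/Z - 1\<bar> \<sqdot> Z/Zt\<close> and apply the Cauchy--Schwarz inequality in \<open>\<omega>\<close> at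
  each fixed \<open>\<theta>\<close>.
\<close>

lemma power2_le_imp_le_ennreal:
  fixes x y :: ennreal
  assumes "x\<^sup>2 \<le> y\<^sup>2"
  shows "x \<le> y"
proof (cases x; cases y)
  fix a b assume "x = ennreal a" "0 \<le> a" "y = ennreal b" "0 \<le> b"
  with assms show ?thesis
    by (auto simp: ennreal_power intro!: ennreal_leI power2_le_imp_le)
qed (use assms in \<open>auto simp: ennreal_power top_unique\<close>)

lemma ennsqrt_power2: "(ennsqrt x)\<^sup>2 = x"
  by (cases x) (auto simp: ennsqrt_def ennreal_power)

lemma Cauchy_Schwarz_ennsqrt:
  assumes "f \<in> borel_measurable M" and "g \<in> borel_measurable M"
  shows "(\<integral>\<^sup>+x. f x * g x \<partial>M) \<le> ennsqrt (\<integral>\<^sup>+x. (f x)\<^sup>2 \<partial>M) * ennsqrt (\<integral>\<^sup>+x. (g x)\<^sup>2 \<partial>M)"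
    (is "?l \<le> ?r")
proof -
  have "?l\<^sup>2 \<le> ?r\<^sup>2"
    using Cauchy_Schwarz_nn_integral[OF assms] by (simp add: power_mult_distrib ennsqrt_power2)
  then show ?thesis
    by (rule power2_le_imp_le_ennreal)
qed

text \<open>
  That the normalized density has total mass one says that \<open>r\<close> has the finite integral \<open>m\<close>. The
  proof then rests on the pointwise identity \<open>1 - r/m = (1 - r) + (m - 1) \<sqdot> r/m\<close>: its last
  term integrates to \<open>m - 1 = \<integral>(r - 1) d\<nu>\<close> and so costs as much as the first one.
\<close>

lemma tv_dist_normalized_density_le:
  fixes \<nu> :: "'a::topological_space measure" and r :: "'a \<Rightarrow> real"
  assumes "prob_space \<nu>" and sets: "sets \<nu> = sets borel"
    and r: "r \<in> borel_measurable borel" and r_nonneg: "\<And>\<theta>. 0 \<le> r \<theta>" and "0 < m"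
    and "prob_space (density \<nu> (\<lambda>\<theta>. ennreal (r \<theta> / m)))"
  shows "tv_dist \<nu> (density \<nu> (\<lambda>\<theta>. ennreal (r \<theta> / m))) \<le> 2 * (\<integral>\<^sup>+\<theta>. ennreal \<bar>r \<theta> - 1\<bar> \<partial>\<nu>)"
proof -
  interpret prob_space \<nu> by fact
  note sets[measurable_cong] r[measurable]
  let ?D = "density \<nu> (\<lambda>\<theta>. ennreal (r \<theta> / m))"
  have "(\<integral>\<^sup>+\<theta>. ennreal (r \<theta> / m) \<partial>\<nu>) = 1"
    using prob_space.emeasure_space_1[OF assms(6)]
    by (simp add: emeasure_density cong: nn_integral_cong_simp)
  then have rm: "has_bochner_integral \<nu> (\<lambda>\<theta>. r \<theta> / m) 1"
    using r_nonneg \<open>0 < m\<close> by (intro has_bochner_integral_nn_integral) auto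
  from has_bochner_integral_mult_right[OF this, of m] \<open>0 < m\<close>
  have "has_bochner_integral \<nu> r m" by simp
  then have int_r: "integrable \<nu> r" and m: "(\<integral>\<theta>. r \<theta> \<partial>\<nu>) = m"
    by (auto simp: has_bochner_integral_iff)
  have int_rm: "integrable \<nu> (\<lambda>\<theta>. r \<theta> / m)"
    using int_r by simp
  let ?I = "\<integral>\<theta>. \<bar>r \<theta> - 1\<bar> \<partial>\<nu>"
  have int_abs: "integrable \<nu> (\<lambda>\<theta>. \<bar>r \<theta> - 1\<bar>)"
    using int_r by simp
  have m1: "\<bar>m - 1\<bar> \<le> ?I"
    using integral_abs_bound[of \<nu> "\<lambda>\<theta>. r \<theta> - 1"] int_r m by (simp add: prob_space)
  have bound: "\<bar>(\<integral>\<theta>. f \<theta> \<partial>\<nu>) - (\<integral>\<theta>. f \<theta> \<partial>?D)\<bar> \<le> 2 * ?I"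
    if f[measurable]: "f \<in> borel_measurable borel" and f1: "\<And>\<theta>. \<bar>f \<theta>\<bar> \<le> 1" for f :: "'a \<Rightarrow> real"
  proof -
    have int_f: "integrable \<nu> f"
      using f1 by (intro integrable_const_bound[where B = 1]) auto
    have int_rf: "integrable \<nu> (\<lambda>\<theta>. r \<theta> / m * f \<theta>)"
      using f1 r_nonneg \<open>0 < m\<close>
      by (intro Bochner_Integration.integrable_bound[OF int_rm])
         (auto simp: abs_mult intro!: mult_left_le divide_right_mono)
    have "(\<integral>\<theta>. f \<theta> \<partial>?D) = (\<integral>\<theta>. r \<theta> / m * f \<theta> \<partial>\<nu>)"
      using r_nonneg \<open>0 < m\<close> by (subst integral_real_density) auto
    then have "\<bar>(\<integral>\<theta>. f \<theta> \<partial>\<nu>) - (\<integral>\<theta>. f \<theta> \<partial>?D)\<bar> = \<bar>\<integral>\<theta>. f \<theta> - r \<theta> / m * f \<theta> \<partial>\<nu>\<bar>"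
      using int_f int_rf by simp
    also have "\<dots> \<le> (\<integral>\<theta>. \<bar>f \<theta> - r \<theta> / m * f \<theta>\<bar> \<partial>\<nu>)"
      by (rule integral_abs_bound)
    also have "\<dots> \<le> (\<integral>\<theta>. \<bar>r \<theta> - 1\<bar> + \<bar>m - 1\<bar> * (r \<theta> / m) \<partial>\<nu>)"
    proof (rule integral_mono)
      fix \<theta>
      have "\<bar>f \<theta> - r \<theta> / m * f \<theta>\<bar> = \<bar>f \<theta>\<bar> * \<bar>1 - r \<theta> / m\<bar>"
        by (simp flip: abs_mult add: algebra_simps)
      also have "\<dots> \<le> \<bar>1 - r \<theta> / m\<bar>"
        using f1[of \<theta>] by (simp add: mult_left_le_one_le)
      also have "1 - r \<theta> / m = (1 - r \<theta>) + (m - 1) * (r \<theta> / m)"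
        using \<open>0 < m\<close> by (simp add: field_simps)
      also have "\<bar>\<dots>\<bar> \<le> \<bar>1 - r \<theta>\<bar> + \<bar>(m - 1) * (r \<theta> / m)\<bar>"
        by (rule abs_triangle_ineq)
      also have "\<dots> = \<bar>r \<theta> - 1\<bar> + \<bar>m - 1\<bar> * (r \<theta> / m)"
        using r_nonneg[of \<theta>] \<open>0 < m\<close> by (simp add: abs_mult abs_minus_commute)
      finally show "\<bar>f \<theta> - r \<theta> / m * f \<theta>\<bar> \<le> \<bar>r \<theta> - 1\<bar> + \<bar>m - 1\<bar> * (r \<theta> / m)" .
    next
      show "integrable \<nu> (\<lambda>\<theta>. \<bar>f \<theta> - r \<theta> / m * f \<theta>\<bar>)"
        using int_f int_rf by (intro integrable_abs Bochner_Integration.integrable_diff)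
      show "integrable \<nu> (\<lambda>\<theta>. \<bar>r \<theta> - 1\<bar> + \<bar>m - 1\<bar> * (r \<theta> / m))"
        using int_abs int_rm by (intro Bochner_Integration.integrable_add integrable_mult_right)
    qed
    also have "\<dots> = ?I + \<bar>m - 1\<bar>"
      using int_abs int_r m \<open>0 < m\<close> by simp
    also have "\<dots> \<le> 2 * ?I"
      using m1 by simp
    finally show ?thesis .
  qed
  have "tv_dist \<nu> ?D \<le> ennreal (2 * ?I)"
    unfolding tv_dist_def using bound by (auto intro!: SUP_least ennreal_leI)
  also have "\<dots> = 2 * (\<integral>\<^sup>+\<theta>. ennreal \<bar>r \<theta> - 1\<bar> \<partial>\<nu>)"
    using int_abs by (simp add: nn_integral_eq_integral ennreal_mult)
  finally show ?thesis .
qed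

lemma sets_gibbs: "sets (gibbs \<mu> \<Phi> Z) = sets \<mu>"
  by (simp add: gibbs_def)

text \<open>
  With a real normalizing constant absorbed into the density, two such measures are compared by
  real arithmetic on their densities with respect to \<open>\<mu>\<close>.
\<close>

lemma gibbs_eq_density:
  assumes "sets \<mu> = sets borel"
    and "\<Phi> \<in> borel_measurable borel" and "Z \<in> borel_measurable borel"
    and "0 < norm_const \<mu> \<Phi> Z" and "norm_const \<mu> \<Phi> Z < \<infinity>"
  shows "gibbs \<mu> \<Phi> Z =
    density \<mu> (\<lambda>\<theta>. ennreal (exp (- \<Phi> \<theta>) / Z \<theta> / enn2real (norm_const \<mu> \<Phi> Z)))"
proof (rule measure_eqI)
  note assms(1)[measurable_cong] assms(2,3)[measurable]
  obtain c where c: "norm_const \<mu> \<Phi> Z = ennreal c" "0 < c"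
    using assms(4,5) by (cases "norm_const \<mu> \<Phi> Z") auto
  fix A assume "A \<in> sets (gibbs \<mu> \<Phi> Z)"
  then have [measurable]: "A \<in> sets \<mu>" by (simp add: sets_gibbs)
  \<comment> \<open>\<open>Z\<close> may take negative values here; \<open>ennreal\<close> sends both sides to 0 there.\<close>
  have "1 / ennreal c * ennreal x = ennreal (x / c)" for x
    using c(2) by (cases "0 \<le> x")
      (auto simp: divide_ennreal ennreal_mult''[symmetric] ennreal_neg divide_nonpos_pos
        simp flip: ennreal_1)
  then show "emeasure (gibbs \<mu> \<Phi> Z) A =
      emeasure (density \<mu> (\<lambda>\<theta>. ennreal (exp (- \<Phi> \<theta>) / Z \<theta> / enn2real (norm_const \<mu> \<Phi> Z)))) A"
    using c by (simp add: gibbs_def emeasure_density mult.assoc[symmetric]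
        flip: nn_integral_cmult)
qed (simp add: sets_gibbs)

text \<open>
  Dividing the densities \<open>exp (-\<Phi>) / (Y \<sqdot> cY)\<close> and \<open>exp (-\<Phi>) / (Z \<sqdot> cZ)\<close> cancels \<open>\<Phi>\<close> and
  leaves \<open>(Z / Y) / (cY / cZ)\<close>, a density normalized by \<open>m = cY / cZ\<close> as in
  \<open>tv_dist_normalized_density_le\<close>.
\<close>

lemma tv_dist_gibbs_le:
  fixes \<mu> :: "'a::topological_space measure"
  assumes "sets \<mu> = sets borel" and "\<Phi> \<in> borel_measurable borel"
    and "Z \<in> borel_measurable borel" and Z: "\<And>\<theta>. 0 < Z \<theta>"
    and Z_const: "0 < norm_const \<mu> \<Phi> Z" "norm_const \<mu> \<Phi> Z < \<infinity>"
    and "Y \<in> borel_measurable borel" and Y: "\<And>\<theta>. 0 < Y \<theta>"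
    and Y_const: "0 < norm_const \<mu> \<Phi> Y" "norm_const \<mu> \<Phi> Y < \<infinity>"
  shows "tv_dist (gibbs \<mu> \<Phi> Z) (gibbs \<mu> \<Phi> Y)
    \<le> 2 * (\<integral>\<^sup>+\<theta>. ennreal \<bar>Z \<theta> / Y \<theta> - 1\<bar> \<partial>gibbs \<mu> \<Phi> Z)"
proof -
  note assms(1)[measurable_cong] assms(2,3,7)[measurable]
  define cZ where "cZ = enn2real (norm_const \<mu> \<Phi> Z)"
  define cY where "cY = enn2real (norm_const \<mu> \<Phi> Y)"
  have pos: "0 < cZ" "0 < cY"
    using Z_const Y_const by (auto simp: cZ_def cY_def enn2real_positive_iff)
  have "gibbs \<mu> \<Phi> Y = density \<mu> (\<lambda>\<theta>. ennreal (exp (- \<Phi> \<theta>) / Y \<theta> / cY))"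
    using gibbs_eq_density[OF assms(1,2,7) Y_const] by (simp add: cY_def)
  also have "(\<lambda>\<theta>. ennreal (exp (- \<Phi> \<theta>) / Y \<theta> / cY)) =
      (\<lambda>\<theta>. ennreal (exp (- \<Phi> \<theta>) / Z \<theta> / cZ) * ennreal (Z \<theta> / Y \<theta> / (cY / cZ)))"
  proof
    fix \<theta>
    show "ennreal (exp (- \<Phi> \<theta>) / Y \<theta> / cY) =
        ennreal (exp (- \<Phi> \<theta>) / Z \<theta> / cZ) * ennreal (Z \<theta> / Y \<theta> / (cY / cZ))"
      using pos Z[of \<theta>] Y[of \<theta>] by (subst ennreal_mult[symmetric]) (auto simp: field_simps)
  qed
  also have "density \<mu> \<dots> =
      density (density \<mu> (\<lambda>\<theta>. ennreal (exp (- \<Phi> \<theta>) / Z \<theta> / cZ)))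
        (\<lambda>\<theta>. ennreal (Z \<theta> / Y \<theta> / (cY / cZ)))"
    by (rule density_density_eq[symmetric]) measurable
  also have "density \<mu> (\<lambda>\<theta>. ennreal (exp (- \<Phi> \<theta>) / Z \<theta> / cZ)) = gibbs \<mu> \<Phi> Z"
    using gibbs_eq_density[OF assms(1-3) Z_const] by (simp add: cZ_def)
  finally have eq: "gibbs \<mu> \<Phi> Y = density (gibbs \<mu> \<Phi> Z) (\<lambda>\<theta>. ennreal (Z \<theta> / Y \<theta> / (cY / cZ)))" .
  show ?thesis
    unfolding eq
  proof (rule tv_dist_normalized_density_le)
    show "prob_space (gibbs \<mu> \<Phi> Z)"
      by (rule prob_space_gibbs[OF assms(1-3) Z_const])
    show "prob_space (density (gibbs \<mu> \<Phi> Z) (\<lambda>\<theta>. ennreal (Z \<theta> / Y \<theta> / (cY / cZ))))"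
      unfolding eq[symmetric] by (rule prob_space_gibbs[OF assms(1,2,7) Y_const])
  qed (use pos Z Y assms(1) in \<open>auto simp: sets_gibbs less_imp_le\<close>)
qed

theorem corollary2p11:
  fixes \<mu> :: "'a::polish_space measure"
    and \<Phi> Z :: "'a \<Rightarrow> real"
    and P :: "'w measure"
    and Zt :: "'w \<Rightarrow> 'a \<Rightarrow> real"
  assumes "sigma_finite_measure \<mu>" and "sets \<mu> = sets borel"
    and "\<Phi> \<in> borel_measurable borel"
    and "prob_space P"
    and "Z \<in> borel_measurable borel" and "\<And>\<theta>. 0 < Z \<theta>"
    and "0 < norm_const \<mu> \<Phi> Z" and "norm_const \<mu> \<Phi> Z < \<infinity>"
    and "(\<lambda>(\<omega>, \<theta>). Zt \<omega> \<theta>) \<in> borel_measurable (P \<Otimes>\<^sub>M borel)"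
    and "\<And>\<omega> \<theta>. \<omega> \<in> space P \<Longrightarrow> 0 < Zt \<omega> \<theta>"
    and "\<And>\<omega>. \<omega> \<in> space P \<Longrightarrow> 0 < norm_const \<mu> \<Phi> (Zt \<omega>)"
    and "\<And>\<omega>. \<omega> \<in> space P \<Longrightarrow> norm_const \<mu> \<Phi> (Zt \<omega>) < \<infinity>"
  shows "(\<integral>\<^sup>+\<omega>. tv_dist (gibbs \<mu> \<Phi> Z) (gibbs \<mu> \<Phi> (Zt \<omega>)) \<partial>P)
      \<le> 2 * (\<integral>\<^sup>+\<theta>. (\<integral>\<^sup>+\<omega>. ennreal \<bar>Z \<theta> / Zt \<omega> \<theta> - 1\<bar> \<partial>P) \<partial>gibbs \<mu> \<Phi> Z)
    \<and> 2 * (\<integral>\<^sup>+\<theta>. (\<integral>\<^sup>+\<omega>. ennreal \<bar>Z \<theta> / Zt \<omega> \<theta> - 1\<bar> \<partial>P) \<partial>gibbs \<mu> \<Phi> Z)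
      \<le> 2 * (\<integral>\<^sup>+\<theta>. ennsqrt (\<integral>\<^sup>+\<omega>. ennreal (\<bar>Zt \<omega> \<theta> / Z \<theta> - 1\<bar>\<^sup>2) \<partial>P)
                 * ennsqrt (\<integral>\<^sup>+\<omega>. ennreal ((Z \<theta> / Zt \<omega> \<theta>)\<^sup>2) \<partial>P) \<partial>gibbs \<mu> \<Phi> Z)"
proof -
  let ?\<nu> = "gibbs \<mu> \<Phi> Z"
  note Z_meas[measurable] = assms(5) and Z_pos = assms(6)
  note Zt_meas[measurable] = assms(9) and Zt_pos = assms(10)
  interpret P: prob_space P by fact
  interpret \<nu>: prob_space ?\<nu>
    by (rule prob_space_gibbs[OF assms(2,3,5,7,8)])
  interpret pair_sigma_finite P ?\<nu> ..
  have sets_\<nu>[measurable_cong]: "sets ?\<nu> = sets borel"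
    by (simp add: sets_gibbs assms(2))
  have "(\<integral>\<^sup>+\<omega>. tv_dist ?\<nu> (gibbs \<mu> \<Phi> (Zt \<omega>)) \<partial>P)
      \<le> (\<integral>\<^sup>+\<omega>. 2 * (\<integral>\<^sup>+\<theta>. ennreal \<bar>Z \<theta> / Zt \<omega> \<theta> - 1\<bar> \<partial>?\<nu>) \<partial>P)"
  proof (rule nn_integral_mono)
    fix \<omega> assume \<omega>: "\<omega> \<in> space P"
    have "Zt \<omega> \<in> borel_measurable borel"
      using measurable_Pair2[OF Zt_meas \<omega>] by simp
    with \<omega> show "tv_dist ?\<nu> (gibbs \<mu> \<Phi> (Zt \<omega>)) \<le> 2 * (\<integral>\<^sup>+\<theta>. ennreal \<bar>Z \<theta> / Zt \<omega> \<theta> - 1\<bar> \<partial>?\<nu>)"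
      using assms by (intro tv_dist_gibbs_le) auto
  qed
  also have "\<dots> = 2 * (\<integral>\<^sup>+\<omega>. (\<integral>\<^sup>+\<theta>. ennreal \<bar>Z \<theta> / Zt \<omega> \<theta> - 1\<bar> \<partial>?\<nu>) \<partial>P)"
    by (rule nn_integral_cmult) measurable
  also have "(\<integral>\<^sup>+\<omega>. (\<integral>\<^sup>+\<theta>. ennreal \<bar>Z \<theta> / Zt \<omega> \<theta> - 1\<bar> \<partial>?\<nu>) \<partial>P)
      = (\<integral>\<^sup>+\<theta>. (\<integral>\<^sup>+\<omega>. ennreal \<bar>Z \<theta> / Zt \<omega> \<theta> - 1\<bar> \<partial>P) \<partial>?\<nu>)"
    by (rule Fubini'[symmetric]) measurable
  finally have tv: "(\<integral>\<^sup>+\<omega>. tv_dist ?\<nu> (gibbs \<mu> \<Phi> (Zt \<omega>)) \<partial>P)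
      \<le> 2 * (\<integral>\<^sup>+\<theta>. (\<integral>\<^sup>+\<omega>. ennreal \<bar>Z \<theta> / Zt \<omega> \<theta> - 1\<bar> \<partial>P) \<partial>?\<nu>)" .
  have CS: "(\<integral>\<^sup>+\<omega>. ennreal \<bar>Z \<theta> / Zt \<omega> \<theta> - 1\<bar> \<partial>P)
      \<le> ennsqrt (\<integral>\<^sup>+\<omega>. ennreal (\<bar>Zt \<omega> \<theta> / Z \<theta> - 1\<bar>\<^sup>2) \<partial>P)
        * ennsqrt (\<integral>\<^sup>+\<omega>. ennreal ((Z \<theta> / Zt \<omega> \<theta>)\<^sup>2) \<partial>P)" for \<theta>
  proof -
    have [measurable]: "(\<lambda>\<omega>. Zt \<omega> \<theta>) \<in> borel_measurable P"
      using measurable_Pair1[OF Zt_meas, of \<theta>] by simp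
    have "ennreal \<bar>Z \<theta> / Zt \<omega> \<theta> - 1\<bar> = ennreal \<bar>Zt \<omega> \<theta> / Z \<theta> - 1\<bar> * ennreal (Z \<theta> / Zt \<omega> \<theta>)"
      if "\<omega> \<in> space P" for \<omega>
    proof -
      have pos: "0 < Z \<theta>" "0 < Zt \<omega> \<theta>"
        using Z_pos Zt_pos that by auto
      then have "\<bar>Zt \<omega> \<theta> / Z \<theta> - 1\<bar> * (Z \<theta> / Zt \<omega> \<theta>) = \<bar>(Zt \<omega> \<theta> / Z \<theta> - 1) * (Z \<theta> / Zt \<omega> \<theta>)\<bar>"
        by (simp add: abs_mult)
      also have "(Zt \<omega> \<theta> / Z \<theta> - 1) * (Z \<theta> / Zt \<omega> \<theta>) = 1 - Z \<theta> / Zt \<omega> \<theta>"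
        using pos by (simp add: field_simps)
      finally show ?thesis
        using pos by (simp add: abs_minus_commute flip: ennreal_mult)
    qed
    then have "(\<integral>\<^sup>+\<omega>. ennreal \<bar>Z \<theta> / Zt \<omega> \<theta> - 1\<bar> \<partial>P) =
        (\<integral>\<^sup>+\<omega>. ennreal \<bar>Zt \<omega> \<theta> / Z \<theta> - 1\<bar> * ennreal (Z \<theta> / Zt \<omega> \<theta>) \<partial>P)"
      by (rule nn_integral_cong)
    also have "\<dots> \<le> ennsqrt (\<integral>\<^sup>+\<omega>. (ennreal \<bar>Zt \<omega> \<theta> / Z \<theta> - 1\<bar>)\<^sup>2 \<partial>P)
        * ennsqrt (\<integral>\<^sup>+\<omega>. (ennreal (Z \<theta> / Zt \<omega> \<theta>))\<^sup>2 \<partial>P)"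
      by (rule Cauchy_Schwarz_ennsqrt) measurable
    also have "(\<integral>\<^sup>+\<omega>. (ennreal (Z \<theta> / Zt \<omega> \<theta>))\<^sup>2 \<partial>P) = (\<integral>\<^sup>+\<omega>. ennreal ((Z \<theta> / Zt \<omega> \<theta>)\<^sup>2) \<partial>P)"
      using Z_pos Zt_pos by (intro nn_integral_cong ennreal_power) (simp add: less_imp_le)
    also have "(\<integral>\<^sup>+\<omega>. (ennreal \<bar>Zt \<omega> \<theta> / Z \<theta> - 1\<bar>)\<^sup>2 \<partial>P) =
        (\<integral>\<^sup>+\<omega>. ennreal (\<bar>Zt \<omega> \<theta> / Z \<theta> - 1\<bar>\<^sup>2) \<partial>P)"
      by (intro nn_integral_cong ennreal_power) simp
    finally show ?thesis .
  qed
  show ?thesis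
    using tv CS by (intro conjI mult_left_mono nn_integral_mono) auto
qed

end
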